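(* Let $\Phi:\mathbb{R}^{+}\to\mathbb{R}^{+}$ be convex and nondecreasing. For every $n\in\mathbb{N}$, let there exist an integer-valued random variable $U_n=\mathfrak{u}(\mathbf{Z}_n)$ (with $\mathfrak{u}:\mathcal{X}_n\times\mathcal{X}_n\to\mathbb{Z}$), a set $\mathcal{U}_n=\{u_1,\ldots,u_{m(n)}\}\subset\mathcal{S}_n$ with $u_1<\cdots<u_{m(n)}$, where $\mathcal{S}_n$ is the support of $U_n$, a random transformation $\mathcal{R}$ on $\mathcal{X}_n\times\mathcal{X}_n$, a positive function $\varphi$ on $\mathbb{N}$, and a universal constant (independent of $n$) $A>0$, such that: (a) for all consecutive elements $u_i,u_{i+1}\in\mathcal{U}_n$ and all $\mathbf{z}_n\in\mathcal{X}_n\times\mathcal{X}_n$, $\mathbb{P}(\mathcal{R}(\mathbf{Z}_n)=\mathbf{z}_n\,|\,U_n=u_i)=\mathbb{P}(\mathbf{Z}_n=\mathbf{z}_n\,|\,U_n=u_{i+1})$; (b) $L_n(\mathcal{R}(\mathbf{Z}_n))-L_n(\mathbf{Z}_n)\geq -A$; (c) $\mathbb{P}(U_n=u)\geq\varphi(n)$ for all $u\in\mathcal{U}_n$. Moreover, let there exist a universal constant $c>0$ such that $m(n)\geq c\,\varphi^{-1}(n)$ for all $n\in\mathbb{N}$, where $\varphi^{-1}(n):=1/\varphi(n)$. If for an $\varepsilon_0>0$ $$\Delta_n(\varepsilon_0):=\mathbb{P}\left(\mathbb{E}\left(L_n(\mathcal{R}(\mathbf{Z}_n))-L_n(\mathbf{Z}_n)\,|\,\mathbf{Z}_n\right)<\varepsilon_0\right)\to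 0,\quad n\to\infty,$$ then, for $n$ large enough, $$\mathbb{E}\left(\Phi\left(|L_n(\mathbf{Z}_n)-\mu_n|\right)\right)\geq\sum_{j=1}^{\frac{c}{8}\varphi^{-1}(n)}\Phi\left(\frac{\varepsilon_0}{2}\left(\frac{c}{8\varphi(n)}+j\right)\right)\varphi(n)+\frac{c}{8}\,\Phi\left(\frac{\varepsilon_0c}{16\varphi(n)}\right)\geq\frac{c}{4}\,\Phi\left(\frac{\varepsilon_0c}{16\varphi(n)}\right),$$ where $\mu_n=\mathbb{E}(L_n(\mathbf{Z}_n))$.
   Context: For each $n$, $\mathbf{X}_n=(X_1,\ldots,X_n)$ and $\mathbf{Y}_n=(Y_1,\ldots,Y_n)$ are two independent random strings having the same distribution, with letters in a fixed finite alphabet $\mathcal{A}$; $\mathcal{X}_n\subseteq\mathcal{A}^n$ is their common sample space, and $\mathbf{Z}_n=(\mathbf{X}_n,\mathbf{Y}_n)$. Let $S:\mathcal{A}\times\mathcal{A}\to\mathbb{R}^{+}$ be a symmetric pairwise scoring function and $\delta\in\mathbb{R}$ a constant gap price. An alignment is a pair $(\boldsymbol\pi,\boldsymbol\mu)$ of increasing integer sequences $1\leq\pi_1<\cdots<\pi_k\leq n$, $1\leq\mu_1<\cdots<\mu_k\leq n$ of the same length $k$. Its score for $\mathbf{Z}_n$ is $\sum_{i=1}^k S(X_{\pi_i},Y_{\mu_i})+\delta(n-k)$. The optimal alignment score $L_n=L_n(\mathbf{Z}_n)$ is the maximum of the scores over all alignments. Here $\mathbb{R}^{+}$ denotes the nonnegative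 reals. A random transformation is a map $\mathcal{R}:\Omega\times\mathcal{X}_n\times\mathcal{X}_n\to\mathcal{X}_n\times\mathcal{X}_n$, where $\Omega$ is a sample space for the extra randomness involved in $\mathcal{R}$; $\mathcal{R}(\mathbf{Z}_n)$ denotes the resulting random element, and the conditional expectation given $\mathbf{Z}_n$ averages over the randomness of $\mathcal{R}$.
   Formalization: The sum's upper limit c/(8φ(n)) is rounded up when it is not an integer, and the first inequality is claimed only for those large n with c/(8φ(n)) ≥ 1; without this the claim can fail (e.g. m(n)=1, φ=c=1). *)

theory Defs
  imports "HOL-Probability.Probability"
begin

definition alignments :: "nat \<Rightarrow> (nat list \<times> nat list) set" where
  "alignments n = {(ps, qs). length ps = length qs
      \<and> sorted_wrt (<) ps \<and> set ps \<subseteq> {1..n}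
      \<and> sorted_wrt (<) qs \<and> set qs \<subseteq> {1..n}}"

(* Positions in an alignment count from 1, list indices count from 0. *)
definition align_score ::
  "('a \<Rightarrow> 'a \<Rightarrow> real) \<Rightarrow> real \<Rightarrow> nat \<Rightarrow> 'a list \<times> 'a list \<Rightarrow> nat list \<times> nat list \<Rightarrow> real" where
  "align_score S \<delta> n = (\<lambda>(x, y) (ps, qs).
      (\<Sum>i<length ps. S (x ! (ps ! i - 1)) (y ! (qs ! i - 1))) + \<delta> * (real n - real (length ps)))"

(* The set of alignments is finite and contains the empty alignment, so the maximum exists. *)
definition opt_score ::
  "('a \<Rightarrow> 'a \<Rightarrow> real) \<Rightarrow> real \<Rightarrow> nat \<Rightarrow> 'a list \<times> 'a list \<Rightarrow> real" where
  "opt_score S \<delta> n z = Max (align_score S \<delta> n z ` alignments n)"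

(* The sample space of M carries both the strings and the extra randomness of R, so a separate
   space for the latter (e.g. a factor of a product space) is covered. In particular
   R w (Z w) is the random element R(Z), and it need not be a function of Z. *)
definition random_transformation ::
  "'w measure \<Rightarrow> 'b set \<Rightarrow> ('w \<Rightarrow> 'b \<Rightarrow> 'b) \<Rightarrow> bool" where
  "random_transformation M D R \<longleftrightarrow> (\<forall>z\<in>D. (\<lambda>\<omega>. R \<omega> z) \<in> M \<rightarrow>\<^sub>M count_space D)"

(* E(F | Z) for a random element Z with values in the finite set D. *)
definition cond_exp_given ::
  "'w measure \<Rightarrow> 'b set \<Rightarrow> ('w \<Rightarrow> 'b) \<Rightarrow> ('w \<Rightarrow> real) \<Rightarrow> 'w \<Rightarrow> real" where
  "cond_exp_given M D Z F = real_cond_exp M (vimage_algebra (space M) Z (count_space D)) F"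

(* Sum over j = 1, ..., x for a positive real upper limit x. If x is not an integer it is rounded
   up; with rounding down, a sum of x terms each at least b would not be bounded below by x * b. *)
definition sum_to :: "real \<Rightarrow> (nat \<Rightarrow> real) \<Rightarrow> real" where
  "sum_to x f = (\<Sum>j = 1..nat \<lceil>x\<rceil>. f j)"

end

theory Submission
  imports Defs
begin

text \<open>
  Write \<open>l\<^sub>i = E(L(Z) | U = u\<^sub>i)\<close> and \<open>K = c / (8 \<phi>)\<close>. By (a), the increment \<open>l\<^sub>i\<^sub>+\<^sub>1 - l\<^sub>i\<close> is the mean of
  \<open>L(R(Z)) - L(Z)\<close> given \<open>U = u\<^sub>i\<close>, so it is at least \<open>\<epsilon>\<^sub>0\<close> up to an error proportional to the
  conditional probability of the exceptional event. The exceptional events for different \<open>i\<close> are disjoint,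
  hence all errors together amount to at most \<open>(A + \<epsilon>\<^sub>0) \<Delta> / \<phi>\<close>, which is eventually below
  \<open>\<epsilon>\<^sub>0 K / 8\<close>. Thus \<open>l\<close> grows almost linearly with slope \<open>\<epsilon>\<^sub>0\<close> over at least \<open>8 K\<close> indices.
  Wherever the mean \<open>\<mu>\<close> lies, at least \<open>4 K\<close> of these indices are on one side of it, and the farther half of
  them contributes the required sum, by Jensen's inequality conditionally on each event \<open>U = u\<^sub>i\<close>.
\<close>

section \<open>A deterministic bound for almost linearly growing sequences\<close>

text \<open>Moving \<open>d\<close> indices away from the place where \<open>l\<close> crosses
  \<open>\<mu>\<close> forces a distance of at least \<open>\<epsilon> * (d - K / 8)\<close>. On the
  longer side of the crossing there are \<open>N \<ge> 4 * K\<close> indices. The farthest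
  \<open>k = \<lceil>K\<rceil>\<close> of them pay for the sum, the next \<open>k\<close> for the
  remaining term. The bound \<open>K \<ge> 1\<close> keeps the rounding error of \<open>k\<close>
  small against \<open>K\<close>.\<close>

lemma sum_ge_of_almost_increasing:
  fixes l :: "nat \<Rightarrow> real" and \<Phi> :: "real \<Rightarrow> real" and K \<epsilon> \<mu> :: real and m :: nat
  assumes nonneg: "\<And>x. x \<ge> 0 \<Longrightarrow> \<Phi> x \<ge> 0"
    and mono: "mono_on {0..} \<Phi>"
    and \<epsilon>: "\<epsilon> > 0" and K: "K \<ge> 1" and m: "real m \<ge> 8 * K"
    and slope: "\<And>i j. 1 \<le> i \<Longrightarrow> i \<le> j \<Longrightarrow> j \<le> m \<Longrightarrow>
      l j - l i \<ge> \<epsilon> * (real j - real i) - \<epsilon> * K / 8"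
  shows "(\<Sum>i=1..m. \<Phi> \<bar>l i - \<mu>\<bar>)
    \<ge> (\<Sum>j=1..nat \<lceil>K\<rceil>. \<Phi> (\<epsilon> / 2 * (K + real j))) + K * \<Phi> (\<epsilon> * K / 2)"
proof -
  define k where "k = nat \<lceil>K\<rceil>"
  have k: "real k \<ge> K" "real k < K + 1" "k \<ge> 1"
    using K unfolding k_def by linarith+
  \<comment> \<open>The last index at which \<open>l\<close> is at most \<open>\<mu>\<close>; the
    inserted 0 is the value when there is none.\<close>
  define s where "s = Max (insert 0 {i\<in>{1..m}. l i \<le> \<mu>})"
  have s_in: "s \<in> insert 0 {i\<in>{1..m}. l i \<le> \<mu>}"
    unfolding s_def by (rule Max_in) auto
  then have s: "s \<le> m" "s \<ge> 1 \<Longrightarrow> l s \<le> \<mu>" by auto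
  have above: "l i > \<mu>" if "i > s" "i \<le> m" for i
  proof (rule ccontr)
    assume "\<not> l i > \<mu>"
    then have "i \<le> s" unfolding s_def using that by (intro Max_ge) auto
    with that show False by simp
  qed
  \<comment> \<open>\<open>g\<close> lists the indices on the longer side of the crossing,
    \<open>d\<close> counting the steps away from it: downwards from \<open>s\<close> if
    \<open>s \<ge> 4 * K\<close>, otherwise upwards from \<open>s + 1\<close>, the first index after
    which all values exceed \<open>\<mu>\<close>, itself included.\<close>
  obtain N :: nat and g :: "nat \<Rightarrow> nat" where N: "real N \<ge> 4 * K"
    and inj: "inj_on g {..<N}" and g: "g ` {..<N} \<subseteq> {1..m}"
    and far: "\<And>d. d < N \<Longrightarrow> \<bar>l (g d) - \<mu>\<bar> \<ge> \<epsilon> * (real d - K / 8)"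
  proof (cases "real s \<ge> 4 * K")
    case True
    show thesis
    proof (rule that[of s "\<lambda>d. s - d"])
      show "inj_on (\<lambda>d. s - d) {..<s}" by (auto simp: inj_on_def)
      show "(\<lambda>d. s - d) ` {..<s} \<subseteq> {1..m}" using s(1) by auto
      fix d assume d: "d < s"
      have "l s - l (s - d) \<ge> \<epsilon> * (real s - real (s - d)) - \<epsilon> * K / 8"
        using d s(1) by (intro slope) auto
      then show "\<bar>l (s - d) - \<mu>\<bar> \<ge> \<epsilon> * (real d - K / 8)"
        using s(2) d by (simp add: algebra_simps)
    qed (fact True)
  next
    case False
    show thesis
    proof (rule that[of "m - s" "\<lambda>d. s + 1 + d"])
      show "4 * K \<le> real (m - s)" using False m s(1) by simp
      show "inj_on (\<lambda>d. s + 1 + d) {..<m - s}" by (auto simp: inj_on_def)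
      show "(\<lambda>d. s + 1 + d) ` {..<m - s} \<subseteq> {1..m}" by auto
      fix d assume d: "d < m - s"
      have "l (s + 1 + d) - l (s + 1) \<ge> \<epsilon> * (real (s + 1 + d) - real (s + 1)) - \<epsilon> * K / 8"
        using d by (intro slope) auto
      moreover have "l (s + 1) > \<mu>" using d by (intro above) auto
      ultimately show "\<bar>l (s + 1 + d) - \<mu>\<bar> \<ge> \<epsilon> * (real d - K / 8)"
        by (simp add: algebra_simps)
    qed
  qed
  have \<Phi>_le: "\<Phi> (\<epsilon> * y) \<le> \<Phi> \<bar>l (g d) - \<mu>\<bar>" if "d < N" "0 \<le> y" "y \<le> real d - K / 8" for d y
  proof -
    have "\<epsilon> * y \<le> \<epsilon> * (real d - K / 8)" using that \<epsilon> by simp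
    then have "\<epsilon> * y \<le> \<bar>l (g d) - \<mu>\<bar>" using far[OF that(1)] by linarith
    with that \<epsilon> show ?thesis by (intro mono_onD[OF mono]) auto
  qed
  \<comment> \<open>Since 5/8 = 1/2 + 1/8, every \<open>d \<ge> N - 2 * k\<close> then satisfies
    \<open>d - K / 8 \<ge> K / 2\<close>. For \<open>K > 8 / 5\<close> the estimate
    \<open>k < K + 1\<close> suffices. For smaller \<open>K\<close> integrality enters: if
    \<open>1 < K \<le> 8 / 5\<close>, then \<open>k = 2\<close> and \<open>N \<ge> 5\<close>, so the
    difference is at least 1, which is at least \<open>5 / 8 * K\<close>.\<close>
  have kN: "2 * k \<le> N" and low: "real N - 2 * real k \<ge> 5 / 8 * K"
  proof -
    have "K = 1 \<or> (1 < K \<and> K \<le> 8 / 5) \<or> 8 / 5 < K" using K by linarith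
    then have "real N - 2 * real k \<ge> 5 / 8 * K"
    proof (elim disjE)
      assume "1 < K \<and> K \<le> 8 / 5"
      then have "k = 2" "N \<ge> 5" using k N by linarith+
      with \<open>1 < K \<and> K \<le> 8 / 5\<close> show ?thesis by simp
    next
      assume "K = 1"
      then have "k = 1" using k by linarith
      with \<open>K = 1\<close> N show ?thesis by simp
    next
      assume "8 / 5 < K"
      then show ?thesis using k N by linarith
    qed
    then show "real N - 2 * real k \<ge> 5 / 8 * K" .
    with K show "2 * k \<le> N" by linarith
  qed
  \<comment> \<open>The nearer block \<open>{N - 2 * k..<N - k}\<close> has \<open>k \<ge> K\<close>
    terms, each at least \<open>\<Phi> (\<epsilon> * K / 2)\<close>.\<close>
  have "K * \<Phi> (\<epsilon> * K / 2) \<le> (\<Sum>j<k. \<Phi> (\<epsilon> * (K / 2)))"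
    using k nonneg[of "\<epsilon> * K / 2"] \<epsilon> K by (simp add: mult_right_mono)
  also have "\<dots> \<le> (\<Sum>j<k. \<Phi> \<bar>l (g (N - 2 * k + j)) - \<mu>\<bar>)"
    using kN low K by (intro sum_mono \<Phi>_le) auto
  also have "\<dots> = (\<Sum>d\<in>{N - 2 * k..<N - k}. \<Phi> \<bar>l (g d) - \<mu>\<bar>)"
    using kN by (intro sum.reindex_bij_witness[of _ "\<lambda>d. d - (N - 2 * k)" "\<lambda>j. N - 2 * k + j"]) auto
  finally have 1: "K * \<Phi> (\<epsilon> * K / 2) \<le> \<dots>" .
  \<comment> \<open>The farther block \<open>{N - k..<N}\<close> is matched term by term; the shift
    by 1 aligns \<open>j = 1\<close> with \<open>d = N - k\<close>.\<close>
  have "(\<Sum>j=1..k. \<Phi> (\<epsilon> / 2 * (K + real j))) = (\<Sum>j=1..k. \<Phi> (\<epsilon> * ((K + real j) / 2)))"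
    by (simp add: algebra_simps)
  also have "\<dots> \<le> (\<Sum>j=1..k. \<Phi> \<bar>l (g (N - k - 1 + j)) - \<mu>\<bar>)"
  proof (intro sum_mono \<Phi>_le)
    fix j assume j: "j \<in> {1..k}"
    have "real (N - k - 1 + j) = real N - real k - 1 + real j"
      using kN k j by simp
    then show "(K + real j) / 2 \<le> real (N - k - 1 + j) - K / 8"
      using N k K j by (simp add: field_simps)
  qed (use kN k K in auto)
  also have "\<dots> = (\<Sum>d\<in>{N - k..<N}. \<Phi> \<bar>l (g d) - \<mu>\<bar>)"
    using kN k by (intro sum.reindex_bij_witness[of _ "\<lambda>d. d - (N - k - 1)" "\<lambda>j. N - k - 1 + j"]) auto
  finally have 2: "(\<Sum>j=1..k. \<Phi> (\<epsilon> / 2 * (K + real j))) \<le> \<dots>" .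
  have "(\<Sum>j=1..k. \<Phi> (\<epsilon> / 2 * (K + real j))) + K * \<Phi> (\<epsilon> * K / 2)
      \<le> (\<Sum>d\<in>{N - k..<N} \<union> {N - 2 * k..<N - k}. \<Phi> \<bar>l (g d) - \<mu>\<bar>)"
    using 1 2 by (subst sum.union_disjoint) auto
  also have "\<dots> \<le> (\<Sum>d<N. \<Phi> \<bar>l (g d) - \<mu>\<bar>)"
    by (intro sum_mono2 nonneg) auto
  also have "\<dots> = (\<Sum>i\<in>g ` {..<N}. \<Phi> \<bar>l i - \<mu>\<bar>)"
    by (simp add: sum.reindex[OF inj])
  also have "\<dots> \<le> (\<Sum>i=1..m. \<Phi> \<bar>l i - \<mu>\<bar>)"
    using g by (intro sum_mono2 nonneg) auto
  finally show ?thesis unfolding k_def .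
qed

section \<open>Means and Jensen's inequality conditionally on an event\<close>

text \<open>On the sample space, \<open>f (V \<omega>)\<close> is a finite combination of indicators
  of the events \<open>V \<omega> = z\<close>.\<close>

lemma (in prob_space) integral_finite_range:
  fixes f :: "'b \<Rightarrow> real"
  assumes D: "finite D" and V[measurable]: "V \<in> M \<rightarrow>\<^sub>M count_space D"
    and B[measurable]: "Measurable.pred M B"
  shows "integrable M (\<lambda>\<omega>. f (V \<omega>))"
    and "(\<integral>\<omega>\<in>{\<omega>\<in>space M. B \<omega>}. f (V \<omega>) \<partial>M) = (\<Sum>z\<in>D. f z * \<P>(\<omega> in M. V \<omega> = z \<and> B \<omega>))"
proof -
  have VD: "V \<omega> \<in> D" if "\<omega> \<in> space M" for \<omega>
    using measurable_space[OF V that] by simp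
  have VE[measurable]: "{\<omega>\<in>space M. V \<omega> = z \<and> P \<omega>} \<in> events" if [measurable]: "Measurable.pred M P" for z P
  proof -
    have "Measurable.pred M (\<lambda>\<omega>. V \<omega> = z)"
      by (rule measurable_compose[OF V]) simp
    then show ?thesis by measurable
  qed
  have split: "(\<Sum>z\<in>D. f z * indicator {\<omega>\<in>space M. V \<omega> = z \<and> P \<omega>} \<omega>)
      = (if P \<omega> then f (V \<omega>) else 0)" if "\<omega> \<in> space M" for P \<omega>
    using VD[OF that] that D by (auto simp: indicator_def if_distrib cong: if_cong)
  have "integrable M (\<lambda>\<omega>. \<Sum>z\<in>D. f z * indicator {\<omega>\<in>space M. V \<omega> = z \<and> True} \<omega>)"
    by (intro Bochner_Integration.integrable_sum integrable_mult_right integrable_real_indicator VE)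
       (auto simp: less_top[symmetric])
  then show "integrable M (\<lambda>\<omega>. f (V \<omega>))"
    by (rule Bochner_Integration.integrable_cong[THEN iffD1, rotated -1]) (auto simp: split[of _ "\<lambda>_. True", simplified])
  have "(\<integral>\<omega>\<in>{\<omega>\<in>space M. B \<omega>}. f (V \<omega>) \<partial>M)
      = (\<integral>\<omega>. (\<Sum>z\<in>D. f z * indicator {\<omega>\<in>space M. V \<omega> = z \<and> B \<omega>} \<omega>) \<partial>M)"
    unfolding set_lebesgue_integral_def
    by (intro Bochner_Integration.integral_cong) (auto simp: split)
  also have "\<dots> = (\<Sum>z\<in>D. f z * \<P>(\<omega> in M. V \<omega> = z \<and> B \<omega>))"
    using VE[OF B] by (subst Bochner_Integration.integral_sum)
      (auto simp: less_top[symmetric])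
  finally show "(\<integral>\<omega>\<in>{\<omega>\<in>space M. B \<omega>}. f (V \<omega>) \<partial>M) = \<dots>" .
qed

text \<open>Links integrals over an event to elementary conditional probabilities, the language in
  which the transformation hypothesis is stated.\<close>

lemma (in prob_space) set_integral_eq_cond_mean:
  fixes f :: "'b \<Rightarrow> real"
  assumes "finite D" "V \<in> M \<rightarrow>\<^sub>M count_space D" "Measurable.pred M B"
    and "\<P>(\<omega> in M. B \<omega>) > 0"
  shows "(\<integral>\<omega>\<in>{\<omega>\<in>space M. B \<omega>}. f (V \<omega>) \<partial>M)
    = \<P>(\<omega> in M. B \<omega>) * (\<Sum>z\<in>D. f z * \<P>(\<omega> in M. V \<omega> = z \<bar> B \<omega>))"
  using assms(4) unfolding integral_finite_range(2)[OF assms(1-3)] cond_prob_def sum_distrib_left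
  by (intro sum.cong) auto

lemma (in prob_space) sum_cond_prob_eq_1:
  assumes "finite D" "V \<in> M \<rightarrow>\<^sub>M count_space D" "Measurable.pred M B"
    and "\<P>(\<omega> in M. B \<omega>) > 0"
  shows "(\<Sum>z\<in>D. \<P>(\<omega> in M. V \<omega> = z \<bar> B \<omega>)) = 1"
  using set_integral_eq_cond_mean[OF assms, of "\<lambda>_. 1"] assms(3,4)
  by (simp add: set_lebesgue_integral_def)

text \<open>The conditional probabilities of the values of \<open>V\<close> are convex weights. As
  \<open>\<Phi>\<close> is convex only on the nonnegative reals, the triangle inequality and
  monotonicity first bring the absolute value inside the mean; finite Jensen follows.\<close>

lemma (in prob_space) cond_Jensen:
  fixes f :: "'b \<Rightarrow> real"
  assumes V: "finite D" "V \<in> M \<rightarrow>\<^sub>M count_space D" "Measurable.pred M B"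
    and pos: "\<P>(\<omega> in M. B \<omega>) > 0"
    and convex: "convex_on {0..} \<Phi>" and mono: "mono_on {0..} \<Phi>"
  shows "(\<integral>\<omega>\<in>{\<omega>\<in>space M. B \<omega>}. \<Phi> \<bar>f (V \<omega>) - \<mu>\<bar> \<partial>M)
    \<ge> \<P>(\<omega> in M. B \<omega>) * \<Phi> \<bar>(\<Sum>z\<in>D. f z * \<P>(\<omega> in M. V \<omega> = z \<bar> B \<omega>)) - \<mu>\<bar>"
proof -
  define w where "w z = \<P>(\<omega> in M. V \<omega> = z \<bar> B \<omega>)" for z
  have w1: "sum w D = 1" unfolding w_def by (rule sum_cond_prob_eq_1[OF V pos])
  have w0: "w z \<ge> 0" for z by (simp add: w_def cond_prob_def)
  have "\<bar>(\<Sum>z\<in>D. f z * w z) - \<mu>\<bar> = \<bar>\<Sum>z\<in>D. w z * (f z - \<mu>)\<bar>"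
    using w1 by (simp add: algebra_simps sum_subtractf flip: sum_distrib_left)
  also have "\<dots> \<le> (\<Sum>z\<in>D. w z * \<bar>f z - \<mu>\<bar>)"
    using sum_abs[of "\<lambda>z. w z * (f z - \<mu>)" D] w0 by (simp add: abs_mult)
  finally have "\<Phi> \<bar>(\<Sum>z\<in>D. f z * w z) - \<mu>\<bar> \<le> \<Phi> (\<Sum>z\<in>D. w z * \<bar>f z - \<mu>\<bar>)"
    by (intro mono_onD[OF mono]) (auto intro!: sum_nonneg mult_nonneg_nonneg w0)
  also have "\<dots> \<le> (\<Sum>z\<in>D. w z * \<Phi> \<bar>f z - \<mu>\<bar>)"
    using convex_on_sum[OF V(1) _ convex w1 w0, of "\<lambda>z. \<bar>f z - \<mu>\<bar>"] w1
    \<comment> \<open>Jensen's inequality wants a nonempty index set; an empty \<open>D\<close>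
      would contradict the weights having sum 1.\<close>
    by (cases "D = {}") auto
  finally show ?thesis
    using pos unfolding set_integral_eq_cond_mean[OF V pos, of "\<lambda>z. \<Phi> \<bar>f z - \<mu>\<bar>"] w_def
    by (simp add: mult.commute mult_left_mono)
qed

section \<open>Growth of the conditional means and the resulting deviation bound\<close>

text \<open>By \<open>shift\<close>, the difference is the mean of
  \<open>f (V \<omega>) - f (Z \<omega>)\<close> given \<open>v (Z \<omega>) = a\<close>. There
  \<open>C\<close> may replace the integrand, and \<open>C\<close> is at least
  \<open>\<epsilon>\<close> except on the exceptional event, where it is still at least
  \<open>- A\<close> almost surely.\<close>

lemma (in prob_space) cond_mean_step:
  fixes f :: "'b \<Rightarrow> real" and v :: "'b \<Rightarrow> 'c"
  assumes D: "finite D" and Z: "Z \<in> M \<rightarrow>\<^sub>M count_space D" and V: "V \<in> M \<rightarrow>\<^sub>M count_space D"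
    and pos: "\<P>(\<omega> in M. v (Z \<omega>) = a) > 0"
    and shift: "\<And>z. z \<in> D \<Longrightarrow> \<P>(\<omega> in M. V \<omega> = z \<bar> v (Z \<omega>) = a) = \<P>(\<omega> in M. Z \<omega> = z \<bar> v (Z \<omega>) = b)"
    and ge: "AE \<omega> in M. f (V \<omega>) - f (Z \<omega>) \<ge> - A"
  defines "C \<equiv> cond_exp_given M D Z (\<lambda>\<omega>. f (V \<omega>) - f (Z \<omega>))"
  shows "(\<Sum>z\<in>D. f z * \<P>(\<omega> in M. Z \<omega> = z \<bar> v (Z \<omega>) = b))
      - (\<Sum>z\<in>D. f z * \<P>(\<omega> in M. Z \<omega> = z \<bar> v (Z \<omega>) = a))
    \<ge> \<epsilon> - (A + \<epsilon>) * \<P>(\<omega> in M. v (Z \<omega>) = a \<and> C \<omega> < \<epsilon>) / \<P>(\<omega> in M. v (Z \<omega>) = a)"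
proof -
  define F where "F = vimage_algebra (space M) Z (count_space D)"
  define G where "G \<omega> = f (V \<omega>) - f (Z \<omega>)" for \<omega>
  define B where "B = {\<omega>\<in>space M. v (Z \<omega>) = a}"
  have C: "C = real_cond_exp M F G"
    unfolding C_def cond_exp_given_def F_def G_def ..
  have ZD: "Z \<in> space M \<rightarrow> D" using measurable_space[OF Z] by auto
  have "sets F \<subseteq> sets M"
    using measurable_sets[OF Z] ZD by (auto simp: F_def sets_vimage_algebra2)
  then have sub: "subalgebra M F" by (simp add: subalgebra_def F_def)
  interpret F: finite_measure_subalgebra M F by unfold_locales (fact sub)
  have pred[measurable]: "Measurable.pred M (\<lambda>\<omega>. v (Z \<omega>) = a)"
    by (rule measurable_compose[OF Z]) simp
  have int_f: "integrable M (\<lambda>\<omega>. f (V \<omega>))" "integrable M (\<lambda>\<omega>. f (Z \<omega>))"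
    by (rule integral_finite_range(1)[OF D V pred] integral_finite_range(1)[OF D Z pred])+
  then have int_G: "integrable M G" unfolding G_def by simp
  have Cm[measurable]: "C \<in> borel_measurable M" unfolding C by simp
  have int_C: "integrable M C" unfolding C using int_G by (rule F.real_cond_exp_int)
  \<comment> \<open>The event depends on \<open>Z\<close> alone, so it lies in \<open>F\<close>;
    hence \<open>C\<close> and \<open>G\<close> have the same integral over it.\<close>
  have "B = Z -` {z\<in>D. v z = a} \<inter> space M" unfolding B_def using ZD by auto
  then have BF: "B \<in> sets F" unfolding F_def by (simp only:) (intro in_vimage_algebra, auto)
  have BM[measurable]: "B \<in> events" unfolding B_def by simp
  have int_B: "integrable M (\<lambda>\<omega>. indicator B \<omega> * g \<omega>)" if "integrable M g" for g :: "'a \<Rightarrow> real"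
    using integrable_mult_indicator[OF BM that] by simp
  have C_ge: "AE \<omega> in M. C \<omega> \<ge> - A"
    unfolding C using F.real_cond_exp_ge_c[OF int_G] ge by (simp add: G_def)
  let ?p = "prob B" and ?Q = "{\<omega>\<in>space M. v (Z \<omega>) = a \<and> C \<omega> < \<epsilon>}"
  have Q[measurable]: "?Q \<in> events" by measurable
  \<comment> \<open>The integrand on the right is \<open>\<epsilon>\<close> on \<open>B\<close>
    outside \<open>?Q\<close>, \<open>- A\<close> on \<open>?Q\<close>, and 0 elsewhere: a lower
    bound for \<open>C\<close> restricted to \<open>B\<close>.\<close>
  have "\<epsilon> * ?p - (A + \<epsilon>) * prob ?Q = (\<integral>\<omega>. \<epsilon> * indicator B \<omega> - (A + \<epsilon>) * indicator ?Q \<omega> \<partial>M)"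
    by (subst Bochner_Integration.integral_diff) (auto simp: less_top[symmetric])
  also have "\<dots> \<le> (\<integral>\<omega>. indicator B \<omega> * C \<omega> \<partial>M)"
  proof (intro integral_mono_AE)
    show "AE \<omega> in M. \<epsilon> * indicator B \<omega> - (A + \<epsilon>) * indicator ?Q \<omega> \<le> indicator B \<omega> * C \<omega>"
      using C_ge by eventually_elim (auto simp: B_def indicator_def)
  qed (use int_B[OF int_C] in \<open>auto simp: less_top[symmetric]\<close>)
  also have "\<dots> = (\<integral>\<omega>\<in>B. G \<omega> \<partial>M)"
    using F.real_cond_exp_intA[OF int_G BF] by (simp add: C set_lebesgue_integral_def)
  also have "\<dots> = (\<integral>\<omega>\<in>B. f (V \<omega>) \<partial>M) - (\<integral>\<omega>\<in>B. f (Z \<omega>) \<partial>M)"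
    unfolding G_def using int_f
    by (intro set_integral_diff) (auto simp: set_integrable_def intro: int_B)
  also have "\<dots> = ?p * ((\<Sum>z\<in>D. f z * \<P>(\<omega> in M. V \<omega> = z \<bar> v (Z \<omega>) = a))
      - (\<Sum>z\<in>D. f z * \<P>(\<omega> in M. Z \<omega> = z \<bar> v (Z \<omega>) = a)))"
    unfolding B_def set_integral_eq_cond_mean[OF D V pred pos] set_integral_eq_cond_mean[OF D Z pred pos]
    by (simp add: algebra_simps)
  finally show ?thesis using pos shift by (simp add: B_def field_simps)
qed

text \<open>The bound for one fixed \<open>n\<close>, about an arbitrary centre
  \<open>\<mu>\<close>. Hypothesis \<open>small\<close> keeps the accumulated error of all steps
  within the slack \<open>\<epsilon> * K / 8\<close> that the deterministic bound tolerates.\<close>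

lemma (in prob_space) expectation_convex_deviation_ge:
  fixes f :: "'b \<Rightarrow> real" and v :: "'b \<Rightarrow> 'c" and u :: "nat \<Rightarrow> 'c"
  assumes D: "finite D" and Z: "Z \<in> M \<rightarrow>\<^sub>M count_space D" and V: "V \<in> M \<rightarrow>\<^sub>M count_space D"
    and nonneg: "\<And>x. x \<ge> 0 \<Longrightarrow> \<Phi> x \<ge> 0"
    and convex: "convex_on {0..} \<Phi>" and mono: "mono_on {0..} \<Phi>"
    and inj: "inj_on u {1..m}"
    and \<phi>: "\<phi> > 0" "\<And>i. i \<in> {1..m} \<Longrightarrow> \<P>(\<omega> in M. v (Z \<omega>) = u i) \<ge> \<phi>"
    and shift: "\<And>i z. i \<in> {1..<m} \<Longrightarrow> z \<in> D \<Longrightarrow>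
      \<P>(\<omega> in M. V \<omega> = z \<bar> v (Z \<omega>) = u i) = \<P>(\<omega> in M. Z \<omega> = z \<bar> v (Z \<omega>) = u (i + 1))"
    and A: "A > 0" "AE \<omega> in M. f (V \<omega>) - f (Z \<omega>) \<ge> - A"
    and \<epsilon>: "\<epsilon> > 0" and K: "K \<ge> 1" and m: "real m \<ge> 8 * K"
    and small: "(A + \<epsilon>) *
      \<P>(\<omega> in M. cond_exp_given M D Z (\<lambda>\<omega>. f (V \<omega>) - f (Z \<omega>)) \<omega> < \<epsilon>) \<le> \<phi> * (\<epsilon> * K / 8)"
  shows "(\<integral>\<omega>. \<Phi> \<bar>f (Z \<omega>) - \<mu>\<bar> \<partial>M)
    \<ge> \<phi> * ((\<Sum>j=1..nat \<lceil>K\<rceil>. \<Phi> (\<epsilon> / 2 * (K + real j))) + K * \<Phi> (\<epsilon> * K / 2))"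
proof -
  define C where "C = cond_exp_given M D Z (\<lambda>\<omega>. f (V \<omega>) - f (Z \<omega>))"
  define B where "B i = {\<omega>\<in>space M. v (Z \<omega>) = u i}" for i
  define l where "l i = (\<Sum>z\<in>D. f z * \<P>(\<omega> in M. Z \<omega> = z \<bar> v (Z \<omega>) = u i))" for i
  have [measurable]: "C \<in> borel_measurable M"
    unfolding C_def cond_exp_given_def by (rule borel_measurable_cond_exp2)
  have vZ[measurable]: "Measurable.pred M (\<lambda>\<omega>. v (Z \<omega>) = a)" for a
    by (rule measurable_compose[OF Z]) simp
  have [measurable]: "B i \<in> events" for i unfolding B_def by measurable
  have pos: "prob (B i) > 0" if "i \<in> {1..m}" for i
    using \<phi>(1) \<phi>(2)[OF that] by (simp add: B_def)
  have disj: "disjoint_family_on B {1..m}"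
    using inj unfolding disjoint_family_on_def B_def inj_on_def by fastforce
  have sets: "{\<omega>\<in>space M. v (Z \<omega>) = u k \<and> C \<omega> < \<epsilon>} \<in> events" for k by measurable
  define e where "e = (\<lambda>i. prob {\<omega>\<in>space M. v (Z \<omega>) = u i \<and> C \<omega> < \<epsilon>})"
  have step: "l (Suc i) - l i \<ge> \<epsilon> - (A + \<epsilon>) / \<phi> * e i" if i: "i \<in> {1..<m}" for i
  proof -
    \<comment> \<open>The common denominator \<open>\<phi>\<close> lets the errors of different
      steps be added.\<close>
    have "(A + \<epsilon>) * e i / prob (B i) \<le> (A + \<epsilon>) * e i / \<phi>"
      using A \<epsilon> \<phi>(1) \<phi>(2)[of i] i by (intro divide_left_mono) (auto simp: e_def B_def)
    moreover have "l (Suc i) - l i \<ge> \<epsilon> - (A + \<epsilon>) * e i / prob (B i)"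
      using cond_mean_step[OF D Z V _ shift[OF i] A(2), of \<epsilon>] pos[of i] i
      by (simp add: l_def e_def C_def B_def)
    ultimately show ?thesis by simp
  qed
  have slope: "l j - l i \<ge> \<epsilon> * (real j - real i) - \<epsilon> * K / 8" if ij: "1 \<le> i" "i \<le> j" "j \<le> m" for i j
  proof -
    \<comment> \<open>Disjointness makes the total error independent of the number of steps: it is
      bounded by a single probability.\<close>
    have "sum e {i..<j} = prob (\<Union>k\<in>{i..<j}. {\<omega>\<in>space M. v (Z \<omega>) = u k \<and> C \<omega> < \<epsilon>})"
      unfolding e_def
    proof (rule finite_measure_finite_Union[symmetric])
      show "disjoint_family_on (\<lambda>k. {\<omega>\<in>space M. v (Z \<omega>) = u k \<and> C \<omega> < \<epsilon>}) {i..<j}"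
      proof (rule disjoint_family_on_bisimulation)
        show "disjoint_family_on B {i..<j}"
          using ij by (intro disjoint_family_on_mono[OF _ disj]) auto
      qed (unfold B_def, blast)
    qed (simp, blast intro: sets)
    also have "\<dots> \<le> \<P>(\<omega> in M. C \<omega> < \<epsilon>)"
      by (intro finite_measure_mono) auto
    finally have "(A + \<epsilon>) / \<phi> * sum e {i..<j} \<le> (A + \<epsilon>) / \<phi> * \<P>(\<omega> in M. C \<omega> < \<epsilon>)"
      using A \<epsilon> \<phi>(1) by (intro mult_left_mono) auto
    also have "\<dots> \<le> \<epsilon> * K / 8"
      using small \<phi>(1) by (simp add: C_def field_simps)
    finally have "\<epsilon> * (real j - real i) - \<epsilon> * K / 8 \<le> \<epsilon> * (real j - real i) - (A + \<epsilon>) / \<phi> * sum e {i..<j}"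
      by simp
    also have "\<dots> = (\<Sum>k=i..<j. \<epsilon> - (A + \<epsilon>) / \<phi> * e k)"
      using ij by (simp add: sum_subtractf sum_distrib_left)
    also have "\<dots> \<le> (\<Sum>k=i..<j. l (Suc k) - l k)"
      using ij by (intro sum_mono step) auto
    also have "\<dots> = l j - l i" using ij by (simp add: sum_Suc_diff')
    finally show ?thesis .
  qed
  have int: "integrable M (\<lambda>\<omega>. \<Phi> \<bar>f (Z \<omega>) - \<mu>\<bar>)"
    by (rule integral_finite_range(1)[OF D Z vZ, of "\<lambda>z. \<Phi> \<bar>f z - \<mu>\<bar>"])
  have int_B: "integrable M (\<lambda>\<omega>. indicator (B i) \<omega> * \<Phi> \<bar>f (Z \<omega>) - \<mu>\<bar>)" for i
    using integrable_mult_indicator[of "B i" M, OF _ int] by simp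
  have "\<phi> * ((\<Sum>j=1..nat \<lceil>K\<rceil>. \<Phi> (\<epsilon> / 2 * (K + real j))) + K * \<Phi> (\<epsilon> * K / 2))
      \<le> \<phi> * (\<Sum>i=1..m. \<Phi> \<bar>l i - \<mu>\<bar>)"
    using \<phi>(1) sum_ge_of_almost_increasing[OF nonneg mono \<epsilon> K m slope] by simp
  also have "\<dots> \<le> (\<Sum>i=1..m. prob (B i) * \<Phi> \<bar>l i - \<mu>\<bar>)"
    unfolding sum_distrib_left using \<phi>(2)
    by (intro sum_mono mult_right_mono nonneg) (auto simp: B_def)
  also have "\<dots> \<le> (\<Sum>i=1..m. \<integral>\<omega>\<in>B i. \<Phi> \<bar>f (Z \<omega>) - \<mu>\<bar> \<partial>M)"
    unfolding l_def B_def using pos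
    by (intro sum_mono cond_Jensen[OF D Z vZ _ convex mono]) (auto simp: B_def)
  also have "\<dots> = (\<integral>\<omega>. (\<Sum>i=1..m. indicator (B i) \<omega> * \<Phi> \<bar>f (Z \<omega>) - \<mu>\<bar>) \<partial>M)"
    unfolding set_lebesgue_integral_def using int
    by (subst Bochner_Integration.integral_sum) (auto intro: int_B)
  also have "\<dots> \<le> (\<integral>\<omega>. \<Phi> \<bar>f (Z \<omega>) - \<mu>\<bar> \<partial>M)"
  proof (intro integral_mono int)
    fix \<omega>
    \<comment> \<open>The events are disjoint, so restricting a nonnegative integrand to each and
      adding up never exceeds it.\<close>
    have "(\<Sum>i=1..m. indicat_real (B i) \<omega>) \<le> 1"
      by (subst indicator_UN_disjoint[OF _ disj, symmetric]) simp_all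
    then show "(\<Sum>i=1..m. indicator (B i) \<omega> * \<Phi> \<bar>f (Z \<omega>) - \<mu>\<bar>) \<le> \<Phi> \<bar>f (Z \<omega>) - \<mu>\<bar>"
      using nonneg[of "\<bar>f (Z \<omega>) - \<mu>\<bar>"] mult_right_mono[of _ 1]
      by (fastforce simp flip: sum_distrib_right)
  qed (intro Bochner_Integration.integrable_sum int_B)
  finally show ?thesis .
qed

text \<open>The guard on the first inequality matters: below it, a single value \<open>u n 1\<close>
  together with a constant score of \<open>Z n\<close> is possible, and the left side is then
  \<open>\<Phi> 0\<close>.\<close>

theorem theorem3p6:
  fixes \<A> :: "'a set"
    and S :: "'a \<Rightarrow> 'a \<Rightarrow> real"
    and \<delta> :: real
    and M :: "nat \<Rightarrow> 'w measure"
    and \<X> :: "nat \<Rightarrow> 'a list set"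
    and X Y :: "nat \<Rightarrow> 'w \<Rightarrow> 'a list"
    and Z :: "nat \<Rightarrow> 'w \<Rightarrow> 'a list \<times> 'a list"
    and L :: "nat \<Rightarrow> 'a list \<times> 'a list \<Rightarrow> real"
    and \<Phi> :: "real \<Rightarrow> real"
    and \<uu> :: "nat \<Rightarrow> 'a list \<times> 'a list \<Rightarrow> int"
    and m :: "nat \<Rightarrow> nat"
    and u :: "nat \<Rightarrow> nat \<Rightarrow> int"
    and R :: "nat \<Rightarrow> 'w \<Rightarrow> 'a list \<times> 'a list \<Rightarrow> 'a list \<times> 'a list"
    and \<phi> :: "nat \<Rightarrow> real"
    and A c \<epsilon>\<^sub>0 :: real
  defines "Z \<equiv> \<lambda>n \<omega>. (X n \<omega>, Y n \<omega>)"
    and "L \<equiv> opt_score S \<delta>"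
  assumes alphabet: "finite \<A>"
    and S_nonneg: "\<And>a b. a \<in> \<A> \<Longrightarrow> b \<in> \<A> \<Longrightarrow> S a b \<ge> 0"
    and S_sym: "\<And>a b. a \<in> \<A> \<Longrightarrow> b \<in> \<A> \<Longrightarrow> S a b = S b a"
    and prob: "\<And>n. n \<ge> 1 \<Longrightarrow> prob_space (M n)"
    and sample_space: "\<And>n. n \<ge> 1 \<Longrightarrow> \<X> n \<subseteq> {x. set x \<subseteq> \<A> \<and> length x = n}"
    and X_meas: "\<And>n. n \<ge> 1 \<Longrightarrow> X n \<in> M n \<rightarrow>\<^sub>M count_space (\<X> n)"
    and Y_meas: "\<And>n. n \<ge> 1 \<Longrightarrow> Y n \<in> M n \<rightarrow>\<^sub>M count_space (\<X> n)"
    and indep: "\<And>n. n \<ge> 1 \<Longrightarrow>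
        prob_space.indep_var (M n) (count_space (\<X> n)) (X n) (count_space (\<X> n)) (Y n)"
    and same_distr: "\<And>n. n \<ge> 1 \<Longrightarrow>
        distr (M n) (count_space (\<X> n)) (X n) = distr (M n) (count_space (\<X> n)) (Y n)"
    and \<Phi>_nonneg: "\<And>x. x \<ge> 0 \<Longrightarrow> \<Phi> x \<ge> 0"
    and \<Phi>_convex: "convex_on {0..} \<Phi>"
    and \<Phi>_mono: "mono_on {0..} \<Phi>"
    and u_increasing: "\<And>n. n \<ge> 1 \<Longrightarrow> strict_mono_on {1..m n} (u n)"
    and u_support: "\<And>n i. n \<ge> 1 \<Longrightarrow> i \<in> {1..m n} \<Longrightarrow>
        \<P>(\<omega> in M n. \<uu> n (Z n \<omega>) = u n i) > 0"
    and R_trans: "\<And>n. n \<ge> 1 \<Longrightarrow> random_transformation (M n) (\<X> n \<times> \<X> n) (R n)"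
    and \<phi>_pos: "\<And>n. n \<ge> 1 \<Longrightarrow> \<phi> n > 0"
    and A_pos: "A > 0"
    and cond_a: "\<And>n i z. n \<ge> 1 \<Longrightarrow> i \<in> {1..<m n} \<Longrightarrow> z \<in> \<X> n \<times> \<X> n \<Longrightarrow>
        \<P>(\<omega> in M n. R n \<omega> (Z n \<omega>) = z \<bar> \<uu> n (Z n \<omega>) = u n i)
          = \<P>(\<omega> in M n. Z n \<omega> = z \<bar> \<uu> n (Z n \<omega>) = u n (i + 1))"
    and cond_b: "\<And>n. n \<ge> 1 \<Longrightarrow>
        (AE \<omega> in M n. L n (R n \<omega> (Z n \<omega>)) - L n (Z n \<omega>) \<ge> - A)"
    and cond_c: "\<And>n i. n \<ge> 1 \<Longrightarrow> i \<in> {1..m n} \<Longrightarrow>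
        \<P>(\<omega> in M n. \<uu> n (Z n \<omega>) = u n i) \<ge> \<phi> n"
    and c_pos: "c > 0"
    and m_ge: "\<And>n. n \<ge> 1 \<Longrightarrow> real (m n) \<ge> c * (1 / \<phi> n)"
    and \<epsilon>\<^sub>0_pos: "\<epsilon>\<^sub>0 > 0"
    and Delta: "(\<lambda>n. \<P>(\<omega> in M n.
          cond_exp_given (M n) (\<X> n \<times> \<X> n) (Z n)
            (\<lambda>\<omega>. L n (R n \<omega> (Z n \<omega>)) - L n (Z n \<omega>)) \<omega> < \<epsilon>\<^sub>0)) \<longlonglongrightarrow> 0"
  shows "\<forall>\<^sub>F n in sequentially.
    (c / 8 * (1 / \<phi> n) \<ge> 1 \<longrightarrow>
       (\<integral>\<omega>. \<Phi> \<bar>L n (Z n \<omega>) - (\<integral>\<omega>'. L n (Z n \<omega>') \<partial>M n)\<bar> \<partial>M n)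
         \<ge> sum_to (c / 8 * (1 / \<phi> n)) (\<lambda>j. \<Phi> (\<epsilon>\<^sub>0 / 2 * (c / (8 * \<phi> n) + real j)) * \<phi> n)
           + c / 8 * \<Phi> (\<epsilon>\<^sub>0 * c / (16 * \<phi> n)))
    \<and> sum_to (c / 8 * (1 / \<phi> n)) (\<lambda>j. \<Phi> (\<epsilon>\<^sub>0 / 2 * (c / (8 * \<phi> n) + real j)) * \<phi> n)
        + c / 8 * \<Phi> (\<epsilon>\<^sub>0 * c / (16 * \<phi> n))
      \<ge> c / 4 * \<Phi> (\<epsilon>\<^sub>0 * c / (16 * \<phi> n))"
proof -
  define D where "D n = \<X> n \<times> \<X> n" for n
  define \<Delta> where "\<Delta> n = \<P>(\<omega> in M n. cond_exp_given (M n) (D n) (Z n)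
    (\<lambda>\<omega>. L n (R n \<omega> (Z n \<omega>)) - L n (Z n \<omega>)) \<omega> < \<epsilon>\<^sub>0)" for n
  \<comment> \<open>With \<open>K = c / (8 * \<phi> n)\<close>, the admissible error
    \<open>\<phi> n * (\<epsilon>\<^sub>0 * K / 8)\<close> equals
    \<open>\<epsilon>\<^sub>0 * c / 64\<close>, free of \<open>n\<close>; hence this
    threshold.\<close>
  have "\<epsilon>\<^sub>0 * c / (64 * (A + \<epsilon>\<^sub>0)) > 0" using A_pos c_pos \<epsilon>\<^sub>0_pos by simp
  with Delta have "\<forall>\<^sub>F n in sequentially. \<Delta> n < \<epsilon>\<^sub>0 * c / (64 * (A + \<epsilon>\<^sub>0))"
    unfolding \<Delta>_def D_def by (rule order_tendstoD(2))
  with eventually_ge_at_top[of 1] show ?thesis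
  proof eventually_elim
    case (elim n)
    then have n: "n \<ge> 1" by simp
    note \<phi> = \<phi>_pos[OF n]
    define K where "K = c / 8 * (1 / \<phi> n)"
    have K: "c / (8 * \<phi> n) = K" "\<epsilon>\<^sub>0 * c / (16 * \<phi> n) = \<epsilon>\<^sub>0 * K / 2" "c / 8 = K * \<phi> n"
      "c / 4 = 2 * K * \<phi> n"
      using \<phi> by (simp_all add: K_def field_simps)
    have K_pos: "K > 0" using \<phi> c_pos by (simp add: K_def)
    let ?rhs = "(\<Sum>j=1..nat \<lceil>K\<rceil>. \<Phi> (\<epsilon>\<^sub>0 / 2 * (K + real j)) * \<phi> n) + K * \<phi> n * \<Phi> (\<epsilon>\<^sub>0 * K / 2)"
    \<comment> \<open>The second inequality holds for every \<open>K > 0\<close>: rounding up leaves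
      at least \<open>K\<close> terms, each at least
      \<open>\<Phi> (\<epsilon>\<^sub>0 * K / 2)\<close>.\<close>
    have "K * \<Phi> (\<epsilon>\<^sub>0 * K / 2) \<le> real (nat \<lceil>K\<rceil>) * \<Phi> (\<epsilon>\<^sub>0 * K / 2)"
      using K_pos \<epsilon>\<^sub>0_pos by (intro mult_right_mono \<Phi>_nonneg) auto
    also have "\<dots> = (\<Sum>j=1..nat \<lceil>K\<rceil>. \<Phi> (\<epsilon>\<^sub>0 * K / 2))" by simp
    also have "\<dots> \<le> (\<Sum>j=1..nat \<lceil>K\<rceil>. \<Phi> (\<epsilon>\<^sub>0 / 2 * (K + real j)))"
      using K_pos \<epsilon>\<^sub>0_pos
      by (intro sum_mono mono_onD[OF \<Phi>_mono]) (auto simp: field_simps)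
    finally have second: "2 * K * \<phi> n * \<Phi> (\<epsilon>\<^sub>0 * K / 2) \<le> ?rhs"
      using \<phi> mult_left_mono[of _ _ "\<phi> n"] by (fastforce simp: algebra_simps simp flip: sum_distrib_left)
    have first: "?rhs \<le> (\<integral>\<omega>. \<Phi> \<bar>L n (Z n \<omega>) - \<mu>\<bar> \<partial>M n)" if K1: "K \<ge> 1" for \<mu>
    proof -
      interpret prob_space "M n" by (rule prob[OF n])
      have "finite (\<X> n)"
        using sample_space[OF n] finite_lists_length_eq[OF alphabet] by (rule finite_subset)
      then have finD: "finite (D n)" by (simp add: D_def)
      have Z: "Z n \<in> M n \<rightarrow>\<^sub>M count_space (D n)"
      proof -
        have "Z n -` {(x, y)} \<inter> space (M n) = (X n -` {x} \<inter> space (M n)) \<inter> (Y n -` {y} \<inter> space (M n))" for x y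
          by (auto simp: Z_def)
        then show ?thesis
          using X_meas[OF n] Y_meas[OF n] finD \<open>finite (\<X> n)\<close>
          by (auto simp: measurable_count_space_eq2 D_def) (auto simp: Z_def)
      qed
      \<comment> \<open>Measurability is given for each fixed argument \<open>z\<close>; as
        \<open>Z n\<close> has finitely many values, the pieces glue together.\<close>
      have V: "(\<lambda>\<omega>. R n \<omega> (Z n \<omega>)) \<in> M n \<rightarrow>\<^sub>M count_space (D n)"
        using R_trans[OF n] unfolding random_transformation_def D_def[symmetric]
        by (intro measurable_compose_countable'[where f = "\<lambda>z \<omega>. R n \<omega> z", OF _ Z countable_finite[OF finD]])
           simp
      have "\<phi> n * ((\<Sum>j=1..nat \<lceil>K\<rceil>. \<Phi> (\<epsilon>\<^sub>0 / 2 * (K + real j))) + K * \<Phi> (\<epsilon>\<^sub>0 * K / 2))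
          \<le> (\<integral>\<omega>. \<Phi> \<bar>L n (Z n \<omega>) - \<mu>\<bar> \<partial>M n)"
      proof (rule expectation_convex_deviation_ge[where f = "L n" and v = "\<uu> n" and u = "u n",
            OF finD Z V \<Phi>_nonneg \<Phi>_convex \<Phi>_mono
            strict_mono_on_imp_inj_on[OF u_increasing[OF n]] \<phi> cond_c[OF n] cond_a[OF n]
            A_pos cond_b[OF n] \<epsilon>\<^sub>0_pos K1])
        show "8 * K \<le> real (m n)" using m_ge[OF n] by (simp add: K_def)
        have "(A + \<epsilon>\<^sub>0) * \<Delta> n \<le> \<epsilon>\<^sub>0 * c / 64"
          using elim(2) A_pos \<epsilon>\<^sub>0_pos by (simp add: field_simps)
        also have "\<dots> = \<phi> n * (\<epsilon>\<^sub>0 * K / 8)" using \<phi> by (simp add: K_def)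
        finally show "(A + \<epsilon>\<^sub>0) * \<P>(\<omega> in M n. cond_exp_given (M n) (D n) (Z n)
            (\<lambda>\<omega>. L n (R n \<omega> (Z n \<omega>)) - L n (Z n \<omega>)) \<omega> < \<epsilon>\<^sub>0) \<le> \<phi> n * (\<epsilon>\<^sub>0 * K / 8)"
          unfolding \<Delta>_def .
      qed (auto simp: D_def)
      then show ?thesis by (simp add: algebra_simps sum_distrib_left)
    qed
    show ?case
      unfolding sum_to_def unfolding K_def[symmetric] unfolding K using first second by blast
  qed
qed

end
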